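(* Let $G=([k],E)$ be a graph. Then $$\mathrm{gex}(G,n)=\Omega\left(n^{\,2-\frac{k-2}{|E|-1}}\right).$$
   Context: Write $[n]=\{1,\dots,n\}$. A graph here means an ordered graph: a linearly ordered vertex set $V$ together with a set $E$ of $2$-element subsets of $V$. A graph $A=(V_1,E_1)$ contains a graph $B=(V_2,E_2)$ if there are an increasing injection $f:V_2\to V_1$ and an injection $g:E_2\to E_1$ with $f(e)\subseteq g(e)$ for every $e\in E_2$; otherwise $A$ avoids $B$. $\mathrm{gex}(G,n)$ is the maximum possible number of edges in a graph with $n$ vertices that avoids $G$. The asymptotic notation is in $n$, with $G$ fixed. *)

theory Defs
  imports Complex_Main "HOL-Library.Landau_Symbols"
begin

(* The linear order on the vertex set is the one induced from the linorder
   class of the vertex type. *)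
record 'a ograph =
  verts :: "'a set"
  edges :: "'a set set"

definition is_ograph :: "'a::linorder ograph \<Rightarrow> bool" where
  "is_ograph A \<longleftrightarrow> (\<forall>e\<in>edges A. e \<subseteq> verts A \<and> card e = 2)"

definition contains :: "'a::linorder ograph \<Rightarrow> 'b::linorder ograph \<Rightarrow> bool" where
  "contains A B \<longleftrightarrow>
     (\<exists>f g. strict_mono_on (verts B) f \<and> f ` verts B \<subseteq> verts A \<and>
            inj_on g (edges B) \<and> g ` edges B \<subseteq> edges A \<and>
            (\<forall>e\<in>edges B. f ` e \<subseteq> g e))"

definition avoids :: "'a::linorder ograph \<Rightarrow> 'b::linorder ograph \<Rightarrow> bool" where
  "avoids A B \<longleftrightarrow> \<not> contains A B"

(* Every finite linear order is isomorphic to a finite set of naturals, so it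
   suffices to let the host graphs have vertices in nat.  The set below is
   always finite; it is nonempty as soon as G has an edge.  (If G has no edge,
   every graph with sufficiently many vertices contains G, there is no maximum,
   and the value of gex is meaningless.) *)
definition gex :: "'a::linorder ograph \<Rightarrow> nat \<Rightarrow> nat" where
  "gex G n = Max {card (edges A) | A :: nat ograph.
     is_ograph A \<and> finite (verts A) \<and> card (verts A) = n \<and> avoids A G}"

end

(* The deletion method.  Choose each pair of vertices independently with
   probability p = n^(-(k-2)/(|E|-1)) / 8.  Since an increasing map is injective,
   every copy of G is a set of exactly |E| pairs, and there are at most n^k
   copies; for this p the expected number of surviving copies is at most half of
   the expected number of chosen pairs.  Removing one edge from every surviving
   copy leaves a graph that avoids G. *)

theory Submission
  imports Defs "HOL-Library.FuncSet"
begin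

text \<open>The summand's weight is the probability that S is the random subset of P keeping each
  element independently with probability p, so the identity says that T survives with probability
  \<open>p ^ card T\<close>. It holds by expanding a product of sums \<open>p + q x\<close> over
  P.\<close>

lemma sum_binomial_weights_supersets:
  fixes p :: real
  assumes "finite P" "T \<subseteq> P"
  shows "(\<Sum>S\<in>Pow P. p ^ card S * (1 - p) ^ card (P - S) * of_bool (T \<subseteq> S)) = p ^ card T"
proof -
  \<comment> \<open>\<open>q x\<close> is the factor for omitting x. Its value 0 on T kills every S
    that misses a point of T, so the indicator is absorbed into the product.\<close>
  define q where "q x = (if x \<in> T then 0 else 1 - p)" for x
  have q: "prod q (P - S) = (1 - p) ^ card (P - S) * of_bool (T \<subseteq> S)" for S
  proof (cases "T \<subseteq> S")
    case True
    then have "prod q (P - S) = (\<Prod>x\<in>P - S. 1 - p)"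
      by (intro prod.cong) (auto simp: q_def)
    with True show ?thesis by simp
  next
    case False
    then obtain x where "x \<in> T" "x \<in> P - S" using assms by auto
    then have "prod q (P - S) = 0"
      using assms(1) by (intro prod_zero) (auto simp: q_def)
    with False show ?thesis by simp
  qed
  have "(\<Sum>S\<in>Pow P. p ^ card S * (1 - p) ^ card (P - S) * of_bool (T \<subseteq> S)) =
      (\<Sum>S\<in>Pow P. (\<Prod>x\<in>S. p) * prod q (P - S))"
    by (simp add: q mult.assoc)
  also have "\<dots> = (\<Prod>x\<in>P. p + q x)"
    using assms(1) by (simp add: prod_add)
  also have "\<dots> = (\<Prod>x\<in>P. if x \<in> T then p else 1)"
    by (intro prod.cong) (auto simp: q_def)
  also have "\<dots> = p ^ card T"
    using assms by (simp add: prod.If_cases Int_absorb1)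
  finally show ?thesis .
qed

text \<open>First moment method: by linearity the left-hand side is the mean of the right-hand side
  over the random subset S, and some S attains at least the mean.\<close>

lemma exists_subset_many_elements_few_blocks:
  fixes p :: real
  assumes "finite P" "finite C" "0 \<le> p" "p \<le> 1"
    and C: "\<And>T. T \<in> C \<Longrightarrow> T \<subseteq> P \<and> card T = m"
  obtains S where "S \<subseteq> P"
    "p * card P - p ^ m * card C \<le> real (card S) - real (card {T \<in> C. T \<subseteq> S})"
proof -
  define w where "w S = p ^ card S * (1 - p) ^ card (P - S)" for S
  define X where "X S = real (card S) - real (card {T \<in> C. T \<subseteq> S})" for S
  define \<mu> where "\<mu> = p * card P - p ^ m * card C"
  have total: "(\<Sum>S\<in>Pow P. w S) = 1"
    using sum_binomial_weights_supersets[OF assms(1), of "{}" p] by (simp add: w_def)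
  \<comment> \<open>Membership is written \<open>{x} \<subseteq> S\<close> so that the superset
    identity evaluates points and blocks alike; \<open>insert_subset\<close> is removed below to
    preserve this form.\<close>
  have X: "X S = (\<Sum>x\<in>P. of_bool ({x} \<subseteq> S)) - (\<Sum>T\<in>C. of_bool (T \<subseteq> S))"
    if "S \<subseteq> P" for S
  proof -
    have "{x \<in> P. x \<in> S} = S" using that by auto
    then show ?thesis
      using assms(1,2) by (simp add: X_def of_bool_def sum.If_cases Int_def)
  qed
  have "(\<Sum>S\<in>Pow P. w S * X S) =
      (\<Sum>S\<in>Pow P. (\<Sum>x\<in>P. w S * of_bool ({x} \<subseteq> S)) - (\<Sum>T\<in>C. w S * of_bool (T \<subseteq> S)))"
    by (intro sum.cong) (simp_all add: X right_diff_distrib sum_distrib_left del: insert_subset)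
  also have "\<dots> = (\<Sum>x\<in>P. \<Sum>S\<in>Pow P. w S * of_bool ({x} \<subseteq> S)) -
      (\<Sum>T\<in>C. \<Sum>S\<in>Pow P. w S * of_bool (T \<subseteq> S))"
    by (subst (1 2) sum.swap) (simp add: sum_subtractf del: insert_subset)
  also have "(\<Sum>x\<in>P. \<Sum>S\<in>Pow P. w S * of_bool ({x} \<subseteq> S)) = (\<Sum>x\<in>P. p)"
  proof (intro sum.cong refl)
    fix x assume "x \<in> P"
    then show "(\<Sum>S\<in>Pow P. w S * of_bool ({x} \<subseteq> S)) = p"
      using sum_binomial_weights_supersets[OF assms(1), of "{x}" p] by (simp add: w_def)
  qed
  also have "(\<Sum>T\<in>C. \<Sum>S\<in>Pow P. w S * of_bool (T \<subseteq> S)) = (\<Sum>T\<in>C. p ^ m)"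
    using C sum_binomial_weights_supersets[OF assms(1)]
    by (intro sum.cong) (simp_all add: w_def)
  finally have mean: "(\<Sum>S\<in>Pow P. w S * X S) = \<mu>"
    by (simp add: \<mu>_def mult.commute)
  have "\<exists>S\<in>Pow P. \<mu> \<le> X S"
  proof (rule ccontr)
    assume "\<not> ?thesis"
    then have less: "\<And>S. S \<in> Pow P \<Longrightarrow> X S < \<mu>" by (auto simp: not_le)
    have nonneg: "0 \<le> w S" for S using assms by (simp add: w_def)
    \<comment> \<open>Strictness of the averaged inequality needs a set of positive weight: for p
      equal to 0 or 1 some weights can vanish, but they cannot all do so because the total is
      1.\<close>
    obtain S where S: "S \<in> Pow P" "w S \<noteq> 0"
      using total by (metis sum.neutral zero_neq_one)
    have "(\<Sum>S\<in>Pow P. w S * X S) < (\<Sum>S\<in>Pow P. w S * \<mu>)"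
    proof (rule sum_strict_mono_ex1)
      show "finite (Pow P)" using assms by simp
      show "\<forall>S\<in>Pow P. w S * X S \<le> w S * \<mu>"
        using nonneg less by (simp add: mult_left_mono less_imp_le)
      have "0 < w S" using S nonneg[of S] by linarith
      then show "\<exists>S\<in>Pow P. w S * X S < w S * \<mu>"
        using S(1) less[OF S(1)] by (intro bexI[of _ S] mult_strict_left_mono)
    qed
    also have "\<dots> = \<mu>" using total by (simp flip: sum_distrib_right)
    finally show False using mean by simp
  qed
  then show ?thesis using that by (auto simp: X_def \<mu>_def)
qed

text \<open>Alteration step: deleting one point from each block inside S destroys all of them and
  costs at most one point per block, which the preceding bound has already subtracted. Since
  \<open>m > 0\<close>, every block has a point to delete.\<close>

lemma exists_independent_subset:
  fixes p :: real
  assumes "finite P" "finite C" "0 \<le> p" "p \<le> 1" "m > 0"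
    and C: "\<And>T. T \<in> C \<Longrightarrow> T \<subseteq> P \<and> card T = m"
  obtains A where "A \<subseteq> P" "\<And>T. T \<in> C \<Longrightarrow> \<not> T \<subseteq> A"
    "p * card P - p ^ m * card C \<le> card A"
proof -
  obtain S where S: "S \<subseteq> P"
    "p * card P - p ^ m * card C \<le> real (card S) - real (card {T \<in> C. T \<subseteq> S})"
    by (rule exists_subset_many_elements_few_blocks[OF assms(1-4) C])
  define D where "D = {T \<in> C. T \<subseteq> S}"
  define h where "h T = (SOME x. x \<in> T)" for T :: "'a set"
  have "h T \<in> T" if "T \<in> C" for T
  proof -
    have "T \<noteq> {}" using C[OF that] \<open>m > 0\<close> by auto
    then show ?thesis unfolding h_def by (rule some_in_eq[THEN iffD2])
  qed
  then have "\<not> T \<subseteq> S - h ` D" if "T \<in> C" for T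
    using that unfolding D_def by blast
  moreover have "real (card S) - real (card D) \<le> card (S - h ` D)"
  proof -
    have "finite D" using assms by (simp add: D_def)
    then have "card S - card D \<le> card (S - h ` D)"
      using card_image_le[of D h] diff_card_le_card_Diff[of "h ` D" S] by simp
    then show ?thesis by linarith
  qed
  ultimately show ?thesis
    using S by (intro that[of "S - h ` D"]) (auto simp: D_def)
qed

text \<open>\<open>Max\<close> bounds its elements only on a finite set. Finiteness follows from the
  crude bound \<open>2 ^ n\<close> on the number of edges, as edges are subsets of the vertex
  set.\<close>

lemma card_edges_le_gex:
  fixes A :: "nat ograph"
  assumes "is_ograph A" "finite (verts A)" "avoids A G"
  shows "card (edges A) \<le> gex G (card (verts A))"
proof -
  have "card (edges B) \<le> 2 ^ n" if "is_ograph B" "finite (verts B)" "card (verts B) = n"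
    for B :: "nat ograph" and n
  proof -
    have "edges B \<subseteq> Pow (verts B)" using that by (auto simp: is_ograph_def)
    then show ?thesis using that by (metis card_Pow card_mono finite_Pow_iff)
  qed
  then have "{card (edges B) | B :: nat ograph. is_ograph B \<and> finite (verts B) \<and>
      card (verts B) = card (verts A) \<and> avoids B G} \<subseteq> {..2 ^ card (verts A)}"
    by blast
  then have "finite {card (edges B) | B :: nat ograph. is_ograph B \<and> finite (verts B) \<and>
      card (verts B) = card (verts A) \<and> avoids B G}"
    by (rule finite_subset) simp
  then show ?thesis
    unfolding gex_def by (rule Max_ge) (use assms in blast)
qed

text \<open>The points are the pairs in \<open>{..<n}\<close> and the blocks are the edge sets of
  the copies of G, so an independent set of points is the edge set of a graph avoiding G.\<close>

lemma gex_deletion_bound: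
  fixes E :: "nat set set" and p :: real
  assumes G: "is_ograph \<lparr>verts = {1..k}, edges = E\<rparr>" and E: "E \<noteq> {}"
    and p: "0 \<le> p" "p \<le> 1"
  shows "p * (n choose 2) - p ^ card E * real n ^ k \<le> gex \<lparr>verts = {1..k}, edges = E\<rparr> n"
proof -
  have sub: "e \<subseteq> {1..k}" "card e = 2" if "e \<in> E" for e
    using G that by (auto simp: is_ograph_def)
  then have "finite E" by (meson PowI finite_Pow_iff finite_atLeastAtMost finite_subset subsetI)
  define P where "P = {e. e \<subseteq> {..<n} \<and> card e = 2}"
  \<comment> \<open>Extensional functions make the embeddings a finite set; forgetting monotonicity
    then bounds their number by \<open>n ^ k\<close>.\<close>
  define F where "F = {f \<in> {1..k} \<rightarrow>\<^sub>E {..<n}. strict_mono_on {1..k} f}"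
  define C where "C = (\<lambda>f. (`) f ` E) ` F"
  have "finite P" unfolding P_def by (rule finite_subset[of _ "Pow {..<n}"]) auto
  have P: "card P = n choose 2" unfolding P_def by (simp add: n_subsets)
  have finPi: "finite ({1..k} \<rightarrow>\<^sub>E {..<n})" by (intro finite_PiE) auto
  then have "finite F" unfolding F_def by simp
  have "card C \<le> card F" unfolding C_def by (rule card_image_le) fact
  also have "\<dots> \<le> card ({1..k} \<rightarrow>\<^sub>E {..<n})"
    by (rule card_mono[OF finPi]) (auto simp: F_def)
  also have "\<dots> = n ^ k" by (simp add: card_PiE)
  finally have cardC: "card C \<le> n ^ k" .
  have C: "T \<subseteq> P \<and> card T = card E" if T: "T \<in> C" for T
  proof -
    obtain f where f: "f \<in> F" "T = (`) f ` E" using T by (auto simp: C_def)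
    then have inj: "inj_on f {1..k}"
      by (auto simp: F_def intro: strict_mono_on_imp_inj_on)
    have "inj_on ((`) f) E"
      using sub(1) inj by (intro inj_on_image inj_on_subset[OF inj]) auto
    moreover have "f ` e \<in> P" if "e \<in> E" for e
    proof -
      have "card (f ` e) = 2"
        using sub[OF that] inj by (simp add: card_image inj_on_subset)
      moreover have "f ` e \<subseteq> {..<n}"
        using sub(1)[OF that] f(1) by (fastforce simp: F_def PiE_iff)
      ultimately show ?thesis by (simp add: P_def)
    qed
    ultimately show ?thesis using f(2) by (auto simp: card_image)
  qed
  have "card E > 0" using \<open>finite E\<close> E by (simp add: card_gt_0_iff)
  have "finite C" unfolding C_def using \<open>finite F\<close> by simp
  obtain A where A: "A \<subseteq> P" "\<And>T. T \<in> C \<Longrightarrow> \<not> T \<subseteq> A"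
    "p * card P - p ^ card E * card C \<le> card A"
    using exists_independent_subset[OF \<open>finite P\<close> \<open>finite C\<close> p \<open>card E > 0\<close> C] by blast
  define H :: "nat ograph" where "H = \<lparr>verts = {..<n}, edges = A\<rparr>"
  have "avoids H \<lparr>verts = {1..k}, edges = E\<rparr>"
    unfolding avoids_def
  proof
    assume "contains H \<lparr>verts = {1..k}, edges = E\<rparr>"
    then obtain f g where f: "strict_mono_on {1..k} f" "f ` {1..k} \<subseteq> {..<n}"
      and g: "g ` E \<subseteq> A" "\<forall>e\<in>E. f ` e \<subseteq> g e"
      by (auto simp: contains_def H_def)
    have inj: "inj_on f {1..k}" using f(1) by (rule strict_mono_on_imp_inj_on)
    \<comment> \<open>The embedding f is arbitrary outside \<open>{1..k}\<close>; restricting it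
      gives a member of F with the same images of edges.\<close>
    define f' where "f' = restrict f {1..k}"
    have "f' \<in> F" using f by (auto simp: F_def f'_def strict_mono_on_def)
    moreover have "f' ` e \<in> A" if e: "e \<in> E" for e
    proof -
      have "g e \<in> P" using g A(1) e by auto
      then have "finite (g e)" "card (g e) = 2"
        by (auto simp: P_def intro: finite_subset)
      moreover have "card (f ` e) = 2"
        using sub[OF e] inj by (simp add: card_image inj_on_subset)
      \<comment> \<open>Both sets have two elements, so the inclusion required by
        \<open>contains\<close> is an equality and g adds no freedom.\<close>
      ultimately have "f ` e = g e"
        using g(2) e by (intro card_subset_eq) auto
      moreover have "f' ` e = f ` e"
        using sub(1)[OF e] by (auto simp: f'_def intro!: image_cong)
      ultimately show ?thesis using g(1) e by auto
    qed
    ultimately show False using A(2)[of "(`) f' ` E"] by (auto simp: C_def)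
  qed
  moreover have "is_ograph H" using A(1) by (auto simp: is_ograph_def H_def P_def)
  ultimately have "card A \<le> gex \<lparr>verts = {1..k}, edges = E\<rparr> n"
    using card_edges_le_gex[of H] by (simp add: H_def)
  moreover have "p ^ card E * card C \<le> p ^ card E * real n ^ k"
    using cardC p by (intro mult_left_mono) (simp_all flip: of_nat_power)
  ultimately show ?thesis using A(3)[unfolded P] by linarith
qed

theorem theorem4p3:
  fixes k :: nat and E :: "nat set set" and G :: "nat ograph"
  assumes "G = \<lparr>verts = {1..k}, edges = E\<rparr>"
    and "is_ograph G"
    and "card E \<ge> 2"
  shows "(\<lambda>n. real (gex G n)) \<in>
    \<Omega>(\<lambda>n. real n powr (2 - (real k - 2) / (real (card E) - 1)))"
proof -
  define m where "m = card E"
  define a where "a = (real k - 2) / (real m - 1)"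
  have m: "m \<ge> 2" using assms by (simp add: m_def)
  have "E \<noteq> {}" using assms(3) by auto
  then obtain e where "e \<subseteq> {1..k}" "card e = 2"
    using assms(1,2) by (auto simp: is_ograph_def)
  \<comment> \<open>An edge needs two vertices; hence \<open>a \<ge> 0\<close>, which keeps the
    probability p below 1.\<close>
  then have "k \<ge> 2" using card_mono[of "{1..k}" e] by simp
  then have "a \<ge> 0" using m by (simp add: a_def)
  \<comment> \<open>One factor 1/8 comes from p, the other from 1/4 - 1/8: there are at least n^2/4
    pairs once \<open>n \<ge> 2\<close>, and the copies cost at most p n^2/8.\<close>
  have bound: "real n powr (2 - a) / 64 \<le> gex G n" if n: "n \<ge> 2" for n
  proof -
    \<comment> \<open>The exponent solves n^(-a(m-1)) n^k = n^2, balancing copies against pairs. As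
      \<open>m - 1 \<ge> 1\<close>, the divisor 8 leaves at least a factor 1/8 in
      \<open>p ^ (m - 1)\<close>.\<close>
    define p where "p = real n powr (- a) / 8"
    have "real n powr (- a) \<le> real n powr 0"
      using n \<open>a \<ge> 0\<close> by (intro powr_mono) auto
    then have p: "0 \<le> p" "p \<le> 1" using n by (simp_all add: p_def)
    have "p ^ (m - 1) * real n ^ k = real n powr (- a * (real m - 1)) * real n powr k / 8 ^ (m - 1)"
      using n m by (simp add: p_def power_divide powr_power powr_realpow of_nat_diff mult.commute)
    also have "\<dots> = real n powr 2 / 8 ^ (m - 1)"
      using m by (simp add: a_def flip: powr_add)
    also have "\<dots> = (real n)\<^sup>2 / 8 ^ (m - 1)"
      using n by simp
    also have "\<dots> \<le> (real n)\<^sup>2 / 8 ^ 1"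
      using m by (intro divide_left_mono power_increasing) auto
    finally have "p * (p ^ (m - 1) * real n ^ k) \<le> p * ((real n)\<^sup>2 / 8)"
      using p by (intro mult_left_mono) auto
    moreover have "p ^ m = p * p ^ (m - 1)" using m by (cases m) auto
    ultimately have copies: "p ^ m * real n ^ k \<le> p * ((real n)\<^sup>2 / 8)"
      by (simp add: mult.assoc)
    have "(real n)\<^sup>2 / 4 \<le> n choose 2"
    proof -
      have "real (n choose 2) = real n * (real n - 1) / 2"
        using n by (simp add: choose_two real_of_nat_div of_nat_diff)
      moreover have "real n * 2 \<le> real n * real n" using n by (intro mult_left_mono) auto
      ultimately show ?thesis by (simp add: power2_eq_square field_simps)
    qed
    then have pairs: "p * ((real n)\<^sup>2 / 4) \<le> p * (n choose 2)"
      using p by (intro mult_left_mono)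
    have "real n powr (2 - a) / 64 = p * ((real n)\<^sup>2 / 8)"
      using n by (simp add: p_def powr_diff powr_minus field_simps)
    also have "\<dots> \<le> p * (n choose 2) - p ^ m * real n ^ k"
      using copies pairs by linarith
    also have "\<dots> \<le> gex G n"
      using gex_deletion_bound[of k E p n] assms \<open>E \<noteq> {}\<close> p by (simp add: m_def)
    finally show ?thesis .
  qed
  have "(\<lambda>n. real (gex G n)) \<in> \<Omega>(\<lambda>n. real n powr (2 - a))"
  proof (rule landau_omega.bigI[of "1/64"])
    show "\<forall>\<^sub>F n in sequentially. 1/64 * norm (real n powr (2 - a)) \<le> norm (real (gex G n))"
      using eventually_ge_at_top[of 2] by eventually_elim (use bound in simp)
  qed simp
  then show ?thesis by (simp add: a_def m_def)
qed

end
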